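(* Let $M=\mathbb{R}^3$ with coordinates $(x,y,z)$, let $g_0=dx^2-dy^2+dz^2$, and let $$V(x,y,z)=\tfrac12x^2-\tfrac12y^2+\tfrac13x^3y^3.$$ Let $\gamma_0:[0,2\pi]\to M$, $\gamma_0(t)=(0,0,t)$, which is a p-geodesic of $(M,g_0,V)$ for which $(0,0,\pi)=\gamma_0(\pi)$ is a conjugate point. Then for every $\alpha\in\mathbb{R}$ the curves $$u_\alpha(t)=(\alpha\sin t,0,t)\quad\text{and}\quad v_\alpha(t)=(0,\alpha\sin t,t),\qquad t\in[0,2\pi],$$ are p-geodesics of $(M,g_0,V)$, and $(0,0,\pi)$ is a bifurcation point on $\gamma_0$. Consequently every conjugate point $\gamma_0(t^\ast)$, $t^\ast\in(0,2\pi)$, along $\gamma_0$ is a bifurcation point.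
   Context: Let $(M,g)$ be a semi-Riemannian manifold with Levi-Civita connection $D$ and $V:M\to\mathbb{R}$ a smooth function (potential). A p-geodesic (perturbed geodesic) of $(M,g,V)$ is a curve $\gamma$ satisfying $\frac{D}{dt}\gamma'(t)+\nabla V(\gamma(t))=0$, where $\nabla V$ is the gradient of $V$ with respect to $g$. Let $\gamma:[a,b]\to M$ be a p-geodesic. Conjugate point: for $t^\ast\in(a,b)$, the point $\gamma(t^\ast)$ is a conjugate point along $\gamma$ if there is a vector field $\xi$ along $\gamma$, not identically zero, which solves $\frac{D^2}{dt^2}\xi(t)+R(\gamma'(t),\xi(t))\gamma'(t)+D_{\xi(t)}\nabla V(\gamma(t))=0$ with $\xi(a)=0$ and $\xi(t^\ast)=0$. The sign convention for the curvature is $R(X,Y)Z=-D_XD_YZ+D_YD_XZ+D_{[X,Y]}Z$ (for the flat metric $g_0$ one has $R=0$). Bifurcation point: for $t^\ast\in(a,b)$, the point $\gamma(t^\ast)$ is a bifurcation point on $\gamma$ if there are a sequence $\{t_n\}_{n\in\mathbb{N}}\subset[a,b]$ converging to $t^\ast$ and p-geodesics $\gamma_n$ of $(M,g,V)$, each defined on a subinterval of $[a,b]$ containing $a$ and $t_n$, such that (i) $\gamma_n(a)=\gamma(a)$ for all $n$; (ii) $\gamma_n(t_n)=\gamma(t_n)$ for all $n$; (iii) $\gamma_n'(a)\to\gamma'(a)$ in $T_{\gamma(a)}M$ as $n\to\infty$; (iv) none of the $\gamma_n$ is a restriction of $\gamma$ to a subinterval of $[a,b]$. *)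

theory Defs
  imports "HOL-Analysis.Analysis"
begin

text \<open>
  Semi-Riemannian geometry on a Euclidean space, regarded as a manifold with its single global chart:
  every tangent space is identified with the space itself, and a metric is a function
  \<open>g p u v\<close> of a point \<open>p\<close> and two tangent vectors \<open>u\<close>, \<open>v\<close> at \<open>p\<close>.
\<close>

definition gradient ::
    "('a::euclidean_space \<Rightarrow> 'a \<Rightarrow> 'a \<Rightarrow> real) \<Rightarrow> ('a \<Rightarrow> real) \<Rightarrow> 'a \<Rightarrow> 'a" where
  "gradient g V p = (THE v. \<forall>w. g p v w = frechet_derivative V (at p) w)"

text \<open>
  \<open>christoffel g p u v\<close> is the value at \<open>p\<close> of the Levi-Civita derivative \<open>D\<^sub>u v\<close> of constant vector
  fields. Constant fields commute, so the symmetry condition says that \<open>D\<close> is torsion-free; the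
  second condition says that \<open>g\<close> is parallel.
\<close>
definition christoffel ::
    "('a::euclidean_space \<Rightarrow> 'a \<Rightarrow> 'a \<Rightarrow> real) \<Rightarrow> 'a \<Rightarrow> 'a \<Rightarrow> 'a \<Rightarrow> 'a" where
  "christoffel g p = (THE \<Gamma>. bilinear \<Gamma> \<and> (\<forall>u v. \<Gamma> u v = \<Gamma> v u) \<and>
     (\<forall>u v w. frechet_derivative (\<lambda>q. g q v w) (at p) u = g p (\<Gamma> u v) w + g p v (\<Gamma> u w)))"

definition levi_civita ::
    "('a::euclidean_space \<Rightarrow> 'a \<Rightarrow> 'a \<Rightarrow> real) \<Rightarrow> ('a \<Rightarrow> 'a) \<Rightarrow> ('a \<Rightarrow> 'a) \<Rightarrow> 'a \<Rightarrow> 'a" where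
  "levi_civita g X Y p = frechet_derivative Y (at p) (X p) + christoffel g p (X p) (Y p)"

definition lie_bracket :: "('a::euclidean_space \<Rightarrow> 'a) \<Rightarrow> ('a \<Rightarrow> 'a) \<Rightarrow> 'a \<Rightarrow> 'a" where
  "lie_bracket X Y p = frechet_derivative Y (at p) (X p) - frechet_derivative X (at p) (Y p)"

text \<open>The sign convention is \<open>R(X,Y)Z = - D\<^sub>X D\<^sub>Y Z + D\<^sub>Y D\<^sub>X Z + D\<^bsub>[X,Y]\<^esub> Z\<close>.\<close>
definition curvature_field ::
    "('a::euclidean_space \<Rightarrow> 'a \<Rightarrow> 'a \<Rightarrow> real) \<Rightarrow> ('a \<Rightarrow> 'a) \<Rightarrow> ('a \<Rightarrow> 'a) \<Rightarrow> ('a \<Rightarrow> 'a) \<Rightarrow> 'a \<Rightarrow> 'a" where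
  "curvature_field g X Y Z p =
     - levi_civita g X (levi_civita g Y Z) p + levi_civita g Y (levi_civita g X Z) p
     + levi_civita g (lie_bracket X Y) Z p"

text \<open>The curvature is tensorial, so tangent vectors may be extended to constant vector fields.\<close>
definition curvature ::
    "('a::euclidean_space \<Rightarrow> 'a \<Rightarrow> 'a \<Rightarrow> real) \<Rightarrow> 'a \<Rightarrow> 'a \<Rightarrow> 'a \<Rightarrow> 'a \<Rightarrow> 'a" where
  "curvature g p u v w = curvature_field g (\<lambda>_. u) (\<lambda>_. v) (\<lambda>_. w) p"

text \<open>
  Curves and vector fields along them are functions on \<open>real\<close> of which only the values on an
  interval \<open>I\<close> matter; hence all derivatives are taken within \<open>I\<close> (one-sided at its end points).
\<close>

definition smooth_curve_on :: "real set \<Rightarrow> (real \<Rightarrow> 'a::euclidean_space) \<Rightarrow> bool" where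
  "smooth_curve_on I c \<longleftrightarrow>
     (\<exists>D. D 0 = c \<and> (\<forall>k::nat. \<forall>t\<in>I. (D k has_vector_derivative D (Suc k) t) (at t within I)))"

definition velocity :: "real set \<Rightarrow> (real \<Rightarrow> 'a::euclidean_space) \<Rightarrow> real \<Rightarrow> 'a" where
  "velocity I c t = vector_derivative c (at t within I)"

definition covariant_derivative ::
    "('a::euclidean_space \<Rightarrow> 'a \<Rightarrow> 'a \<Rightarrow> real) \<Rightarrow> real set \<Rightarrow> (real \<Rightarrow> 'a) \<Rightarrow> (real \<Rightarrow> 'a) \<Rightarrow> real \<Rightarrow> 'a" where
  "covariant_derivative g I c X t =
     vector_derivative X (at t within I) + christoffel g (c t) (velocity I c t) (X t)"

definition p_geodesic ::
    "('a::euclidean_space \<Rightarrow> 'a \<Rightarrow> 'a \<Rightarrow> real) \<Rightarrow> ('a \<Rightarrow> real) \<Rightarrow> real set \<Rightarrow> (real \<Rightarrow> 'a) \<Rightarrow> bool" where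
  "p_geodesic g V I c \<longleftrightarrow>
     is_interval I \<and> (\<exists>s\<in>I. \<exists>t\<in>I. s < t) \<and> smooth_curve_on I c \<and>
     (\<forall>t\<in>I. covariant_derivative g I c (velocity I c) t + gradient g V (c t) = 0)"

definition conjugate_point ::
    "('a::euclidean_space \<Rightarrow> 'a \<Rightarrow> 'a \<Rightarrow> real) \<Rightarrow> ('a \<Rightarrow> real) \<Rightarrow> real \<Rightarrow> real \<Rightarrow> (real \<Rightarrow> 'a) \<Rightarrow> real \<Rightarrow> bool"
  where
  "conjugate_point g V a b c ts \<longleftrightarrow>
     ts \<in> {a<..<b} \<and>
     (\<exists>\<xi>. smooth_curve_on {a..b} \<xi> \<and> (\<exists>t\<in>{a..b}. \<xi> t \<noteq> 0) \<and>
        (\<forall>t\<in>{a..b}.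
           covariant_derivative g {a..b} c (covariant_derivative g {a..b} c \<xi>) t
           + curvature g (c t) (velocity {a..b} c t) (\<xi> t) (velocity {a..b} c t)
           + levi_civita g (\<lambda>_. \<xi> t) (gradient g V) (c t) = 0) \<and>
        \<xi> a = 0 \<and> \<xi> ts = 0)"

definition bifurcation_point ::
    "('a::euclidean_space \<Rightarrow> 'a \<Rightarrow> 'a \<Rightarrow> real) \<Rightarrow> ('a \<Rightarrow> real) \<Rightarrow> real \<Rightarrow> real \<Rightarrow> (real \<Rightarrow> 'a) \<Rightarrow> real \<Rightarrow> bool"
  where
  "bifurcation_point g V a b c ts \<longleftrightarrow>
     ts \<in> {a<..<b} \<and>
     (\<exists>(\<tau> :: nat \<Rightarrow> real) (J :: nat \<Rightarrow> real set) (\<sigma> :: nat \<Rightarrow> real \<Rightarrow> 'a).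
        (\<forall>n. \<tau> n \<in> {a..b}) \<and> \<tau> \<longlonglongrightarrow> ts \<and>
        (\<forall>n. J n \<subseteq> {a..b} \<and> a \<in> J n \<and> \<tau> n \<in> J n \<and> p_geodesic g V (J n) (\<sigma> n)) \<and>
        (\<forall>n. \<sigma> n a = c a) \<and>
        (\<forall>n. \<sigma> n (\<tau> n) = c (\<tau> n)) \<and>
        (\<lambda>n. velocity (J n) (\<sigma> n) a) \<longlonglongrightarrow> velocity {a..b} c a \<and>
        (\<forall>n. \<not> (\<forall>t\<in>J n. \<sigma> n t = c t)))"

definition g0 :: "real^3 \<Rightarrow> real^3 \<Rightarrow> real^3 \<Rightarrow> real" where
  "g0 p u v = u$1 * v$1 - u$2 * v$2 + u$3 * v$3"

lemma g0_semi_riemannian: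
  shows "bilinear (g0 p)" and "g0 p u v = g0 p v u" and "(\<forall>w. g0 p u w = 0) \<Longrightarrow> u = 0"
proof -
  show "bilinear (g0 p)"
    by (auto simp: bilinear_def linear_iff g0_def algebra_simps)
  show "g0 p u v = g0 p v u"
    by (simp add: g0_def mult.commute)
  assume "\<forall>w. g0 p u w = 0"
  then have "g0 p u (axis 1 1) = 0" "g0 p u (axis 2 1) = 0" "g0 p u (axis 3 1) = 0"
    by auto
  then show "u = 0"
    by (simp add: g0_def axis_def vec_eq_iff forall_3)
qed

definition V0 :: "real^3 \<Rightarrow> real" where
  "V0 p = 1/2 * (p$1)^2 - 1/2 * (p$2)^2 + 1/3 * (p$1)^3 * (p$2)^3"

definition gamma0 :: "real \<Rightarrow> real^3" where
  "gamma0 t = vector [0, 0, t]"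

definition u_curve :: "real \<Rightarrow> real \<Rightarrow> real^3" where
  "u_curve \<alpha> t = vector [\<alpha> * sin t, 0, t]"

definition v_curve :: "real \<Rightarrow> real \<Rightarrow> real^3" where
  "v_curve \<alpha> t = vector [0, \<alpha> * sin t, t]"

end

theory Submission
  imports Defs
begin

text \<open>
  The metric \<open>g0\<close> is constant, so its Christoffel symbols and its curvature vanish and covariant
  derivatives are ordinary ones. The gradient of \<open>V0\<close> is \<open>(x + x\<^sup>2 y\<^sup>3, y - x\<^sup>3 y\<^sup>2, 0)\<close>: the
  minus sign of the metric turns the saddle \<open>x\<^sup>2/2 - y\<^sup>2/2\<close> into two oscillators, and the coupling
  disappears on each of the planes \<open>x = 0\<close> and \<open>y = 0\<close>. There the p-geodesic equation is \<open>x'' = -x\<close>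
  or \<open>y'' = -y\<close> together with \<open>z'' = 0\<close>, which \<open>u_curve \<alpha>\<close> and \<open>v_curve \<alpha>\<close> solve. All the
  curves \<open>u_curve \<alpha>\<close> meet \<open>gamma0\<close> at times \<open>0\<close> and \<open>pi\<close>, and they tend to \<open>gamma0\<close> as
  \<open>\<alpha> \<longlonglongrightarrow> 0\<close>, so \<open>pi\<close> is a bifurcation instant.

  The coupling \<open>x\<^sup>3 y\<^sup>3 / 3\<close> has vanishing second derivatives on \<open>gamma0\<close>, so the Jacobi equation along \<open>gamma0\<close> is
  \<open>\<xi>\<^sub>1'' = -\<xi>\<^sub>1\<close>, \<open>\<xi>\<^sub>2'' = -\<xi>\<^sub>2\<close>, \<open>\<xi>\<^sub>3'' = 0\<close>. Solutions vanishing at \<open>0\<close> are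
  \<open>(p sin t, q sin t, r t)\<close>, and a nonzero one can vanish again inside \<open>(0, 2 pi)\<close> only at \<open>pi\<close>.
  Hence \<open>pi\<close> is the only conjugate instant, and the last claim reduces to the previous one.
\<close>

section \<open>The geometry of the flat metric\<close>

text \<open>
  Koszul's argument: \<open>g0 p (\<Gamma> u v) w\<close> is symmetric in \<open>u, v\<close> and, the metric being constant,
  skew in \<open>v, w\<close>; a trilinear form with both properties is zero.
\<close>
lemma christoffel_g0: "christoffel g0 p u v = 0"
proof -
  have const: "frechet_derivative (\<lambda>q. g0 q v w) (at p) u = 0" for u v w
    by (simp add: g0_def)
  have "christoffel g0 p = (\<lambda>u v. 0)"
    unfolding christoffel_def
  proof (rule the_equality)
    show "bilinear (\<lambda>u v. 0 :: real^3) \<and> (\<forall>u v::real^3. (0::real^3) = 0) \<and>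
      (\<forall>u v w. frechet_derivative (\<lambda>q. g0 q v w) (at p) u = g0 p 0 w + g0 p v 0)"
      by (auto simp: const bilinear_def linear_iff) (simp add: g0_def)
  next
    fix \<Gamma> :: "real^3 \<Rightarrow> real^3 \<Rightarrow> real^3"
    assume \<Gamma>: "bilinear \<Gamma> \<and> (\<forall>u v. \<Gamma> u v = \<Gamma> v u) \<and>
      (\<forall>u v w. frechet_derivative (\<lambda>q. g0 q v w) (at p) u = g0 p (\<Gamma> u v) w + g0 p v (\<Gamma> u w))"
    have sym: "\<Gamma> u v = \<Gamma> v u" for u v
      using \<Gamma> by blast
    have skew: "g0 p (\<Gamma> u v) w = - g0 p (\<Gamma> u w) v" for u v w
      using \<Gamma> const[of v w u] g0_semi_riemannian(2)[of p v "\<Gamma> u w"] by simp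
    have "g0 p (\<Gamma> u v) w = 0" for u v w
      using skew[of u v w] skew[of w u v] skew[of v w u] sym[of u v] sym[of v w] sym[of u w]
      by simp
    then show "\<Gamma> = (\<lambda>u v. 0)"
      by (intro ext) (blast intro: g0_semi_riemannian(3))
  qed
  then show ?thesis by simp
qed

lemma levi_civita_g0: "levi_civita g0 X Y = (\<lambda>p. frechet_derivative Y (at p) (X p))"
  by (rule ext) (simp add: levi_civita_def christoffel_g0)

lemma curvature_g0: "curvature g0 p u v w = 0"
  by (simp add: curvature_def curvature_field_def levi_civita_g0)

lemma covariant_derivative_g0:
  "covariant_derivative g0 I c X = (\<lambda>t. vector_derivative X (at t within I))"
  by (rule ext) (simp add: covariant_derivative_def christoffel_g0)

lemma V0_has_derivative:
  "(V0 has_derivative (\<lambda>h. (p$1 + (p$1)^2 * (p$2)^3) * h$1 + (- p$2 + (p$1)^3 * (p$2)^2) * h$2)) (at p)"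
  unfolding V0_def
  by (auto intro!: derivative_eq_intros bounded_linear.has_derivative[OF bounded_linear_vec_nth]
      simp: algebra_simps power2_eq_square power3_eq_cube)

lemma gradient_V0:
  "gradient g0 V0 p = vector [p$1 + (p$1)^2 * (p$2)^3, p$2 - (p$1)^3 * (p$2)^2, 0]"
proof -
  have D: "frechet_derivative V0 (at p) =
      (\<lambda>h. (p$1 + (p$1)^2 * (p$2)^3) * h$1 + (- p$2 + (p$1)^3 * (p$2)^2) * h$2)"
    by (rule frechet_derivative_at[OF V0_has_derivative, symmetric])
  show ?thesis
    unfolding gradient_def D
  proof (rule the_equality)
    show "\<forall>w. g0 p (vector [p$1 + (p$1)^2 * (p$2)^3, p$2 - (p$1)^3 * (p$2)^2, 0]) w =
      (p$1 + (p$1)^2 * (p$2)^3) * w$1 + (- p$2 + (p$1)^3 * (p$2)^2) * w$2"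
      by (auto simp: g0_def algebra_simps)
  next
    fix v
    assume v: "\<forall>w. g0 p v w =
      (p$1 + (p$1)^2 * (p$2)^3) * w$1 + (- p$2 + (p$1)^3 * (p$2)^2) * w$2"
    show "v = vector [p$1 + (p$1)^2 * (p$2)^3, p$2 - (p$1)^3 * (p$2)^2, 0]"
      using v[rule_format, of "axis 1 1"] v[rule_format, of "axis 2 1"] v[rule_format, of "axis 3 1"]
      by (simp add: g0_def axis_def vec_eq_iff forall_3)
  qed
qed

lemma levi_civita_gradient_V0_gamma0:
  "levi_civita g0 (\<lambda>_. h) (gradient g0 V0) (gamma0 t) = vector [h$1, h$2, 0]"
proof -
  have eq: "gradient g0 V0 = (\<lambda>p. (p$1 + (p$1)^2 * (p$2)^3) *\<^sub>R axis 1 1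
      + (p$2 - (p$1)^3 * (p$2)^2) *\<^sub>R axis 2 1)"
    by (rule ext) (simp add: gradient_V0 vec_eq_iff forall_3 axis_def)
  have "(gradient g0 V0 has_derivative (\<lambda>h. h$1 *\<^sub>R axis 1 1 + h$2 *\<^sub>R axis 2 1)) (at (gamma0 t))"
    unfolding eq
    by (auto intro!: derivative_eq_intros bounded_linear.has_derivative[OF bounded_linear_vec_nth]
        simp: gamma0_def)
  then have "frechet_derivative (gradient g0 V0) (at (gamma0 t))
      = (\<lambda>h. h$1 *\<^sub>R axis 1 1 + h$2 *\<^sub>R axis 2 1)"
    by (rule frechet_derivative_at[symmetric])
  then show ?thesis
    by (simp add: levi_civita_g0 vec_eq_iff forall_3 axis_def)
qed

section \<open>Ordinary differential equations along an interval\<close>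

lemma vector_derivative_twice:
  fixes D :: "nat \<Rightarrow> real \<Rightarrow> 'a::euclidean_space"
  assumes "a < b" and t: "t \<in> {a..b}"
    and D: "\<And>k t. t \<in> {a..b} \<Longrightarrow> (D k has_vector_derivative D (Suc k) t) (at t within {a..b})"
  shows "vector_derivative (\<lambda>s. vector_derivative (D 0) (at s within {a..b})) (at t within {a..b})
    = D 2 t"
proof -
  have first: "vector_derivative (D 0) (at s within {a..b}) = D 1 s" if "s \<in> {a..b}" for s
    using vector_derivative_within_closed_interval[OF \<open>a < b\<close> that D[OF that]] by simp
  have "((\<lambda>s. vector_derivative (D 0) (at s within {a..b})) has_vector_derivative D 2 t)
      (at t within {a..b})"
    by (rule has_vector_derivative_transform[OF t first])
       (use D[OF t, of 1] in \<open>simp_all add: numeral_2_eq_2\<close>)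
  then show ?thesis
    by (rule vector_derivative_within_closed_interval[OF \<open>a < b\<close> t])
qed

text \<open>
  In the phase plane, rotating \<open>(f, f')\<close> back by the angle \<open>t\<close> gives a constant vector.
\<close>
lemma harmonic_oscillator_from_zero:
  fixes f f' :: "real \<Rightarrow> real"
  assumes f: "\<And>t. t \<in> {0..b} \<Longrightarrow> (f has_real_derivative f' t) (at t within {0..b})"
    and f': "\<And>t. t \<in> {0..b} \<Longrightarrow> (f' has_real_derivative - f t) (at t within {0..b})"
    and f0: "f 0 = 0" and t: "t \<in> {0..b}"
  shows "f t = f' 0 * sin t"
proof -
  have z: "0 \<in> {0..b}" using t by simp
  have "((\<lambda>t. f t * cos t - f' t * sin t) has_real_derivative 0) (at s within {0..b})"
    if "s \<in> {0..b}" for s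
    by (auto intro!: derivative_eq_intros f f' that)
  from has_field_derivative_zero_constant[OF _ this]
  obtain c where c: "\<And>s. s \<in> {0..b} \<Longrightarrow> f s * cos s - f' s * sin s = c"
    by auto
  have 1: "f t * cos t = f' t * sin t"
    using c[OF t] c[OF z] f0 by simp
  have "((\<lambda>t. f t * sin t + f' t * cos t) has_real_derivative 0) (at s within {0..b})"
    if "s \<in> {0..b}" for s
    by (auto intro!: derivative_eq_intros f f' that)
  from has_field_derivative_zero_constant[OF _ this]
  obtain d where d: "\<And>s. s \<in> {0..b} \<Longrightarrow> f s * sin s + f' s * cos s = d"
    by auto
  have 2: "f t * sin t + f' t * cos t = f' 0"
    using d[OF t] d[OF z] by simp
  have "f t = f t * ((sin t)\<^sup>2 + (cos t)\<^sup>2)"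
    by simp
  also have "\<dots> = (f t * sin t) * sin t + (f t * cos t) * cos t"
    unfolding power2_eq_square by (simp only: algebra_simps)
  also have "\<dots> = (f t * sin t + f' t * cos t) * sin t"
    unfolding 1 by (simp add: algebra_simps)
  finally show ?thesis
    unfolding 2 .
qed

lemma zero_acceleration_from_zero:
  fixes f f' :: "real \<Rightarrow> real"
  assumes f: "\<And>t. t \<in> {0..b} \<Longrightarrow> (f has_real_derivative f' t) (at t within {0..b})"
    and f': "\<And>t. t \<in> {0..b} \<Longrightarrow> (f' has_real_derivative 0) (at t within {0..b})"
    and f0: "f 0 = 0" and t: "t \<in> {0..b}"
  shows "f t = f' 0 * t"
proof -
  have z: "0 \<in> {0..b}" using t by simp
  obtain c where c: "\<And>s. s \<in> {0..b} \<Longrightarrow> f' s = c"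
    using has_field_derivative_zero_constant[OF _ f'] by auto
  have "((\<lambda>t. f t - c * t) has_real_derivative 0) (at s within {0..b})" if "s \<in> {0..b}" for s
    using c[OF that] by (auto intro!: derivative_eq_intros f that)
  from has_field_derivative_zero_constant[OF _ this]
  obtain d where d: "\<And>s. s \<in> {0..b} \<Longrightarrow> f s - c * s = d"
    by auto
  show ?thesis
    using d[OF t] d[OF z] f0 c[OF z] by simp
qed

section \<open>A family of explicit curves\<close>

text \<open>
  The \<open>k\<close>-th derivative of \<open>t \<mapsto> sin t *\<^sub>R A + t *\<^sub>R B\<close>. The curves \<open>gamma0\<close>, \<open>u_curve \<alpha>\<close>,
  \<open>v_curve \<alpha>\<close> and the Jacobi field along \<open>gamma0\<close> are all of this form; shifting the phase by
  \<open>pi / 2\<close> differentiates the sine.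
\<close>
definition sine_jet :: "'a::euclidean_space \<Rightarrow> 'a \<Rightarrow> nat \<Rightarrow> real \<Rightarrow> 'a" where
  "sine_jet A B k t =
     sin (t + real k * (pi / 2)) *\<^sub>R A + (if k = 0 then t else if k = 1 then 1 else 0) *\<^sub>R B"

lemma sine_jet_has_vector_derivative:
  "(sine_jet A B k has_vector_derivative sine_jet A B (Suc k) t) (at t within I)"
proof -
  have shift: "sin (t + real (Suc k) * (pi / 2)) = cos (t + real k * (pi / 2))"
    using sin_add[of "t + real k * (pi / 2)" "pi / 2"] by (simp add: algebra_simps add_divide_distrib)
  have poly: "((\<lambda>t. if k = 0 then t else if k = 1 then 1 else 0) has_real_derivative
      (if Suc k = 0 then t else if Suc k = 1 then 1 else 0)) (at t within I)"
    by (cases "k = 0"; cases "k = 1") auto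
  have trig: "((\<lambda>t. sin (t + real k * (pi / 2))) has_real_derivative
      sin (t + real (Suc k) * (pi / 2))) (at t within I)"
    unfolding shift by (auto intro!: derivative_eq_intros)
  show ?thesis
    using has_vector_derivative_add[OF
        has_vector_derivative_scaleR[OF trig has_vector_derivative_const[of A]]
        has_vector_derivative_scaleR[OF poly has_vector_derivative_const[of B]]]
    by (simp only: sine_jet_def[abs_def] scaleR_zero_right add_0_left)
qed

lemma sine_jet_first: "sine_jet A B 1 t = cos t *\<^sub>R A + B"
  by (simp add: sine_jet_def sin_add)

lemma sine_jet_second: "sine_jet A B 2 t = - sin t *\<^sub>R A"
  by (simp add: sine_jet_def)

lemma smooth_sine_jet: "smooth_curve_on I (sine_jet A B 0)"
  unfolding smooth_curve_on_def using sine_jet_has_vector_derivative by blast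

lemma velocity_sine_jet:
  assumes "a < b" "t \<in> {a..b}"
  shows "velocity {a..b} (sine_jet A B 0) t = cos t *\<^sub>R A + B"
  unfolding velocity_def sine_jet_first[symmetric]
  using vector_derivative_within_closed_interval[OF assms sine_jet_has_vector_derivative] by simp

lemma p_geodesic_sine_jet:
  assumes "a < b" "\<And>t. gradient g0 V0 (sine_jet A B 0 t) = sin t *\<^sub>R A"
  shows "p_geodesic g0 V0 {a..b} (sine_jet A B 0)"
  unfolding p_geodesic_def
proof (intro conjI ballI)
  show "\<exists>s\<in>{a..b}. \<exists>t\<in>{a..b}. s < t"
    using \<open>a < b\<close> by (intro bexI[of _ a] bexI[of _ b]) auto
  fix t assume "t \<in> {a..b}"
  from vector_derivative_twice[OF \<open>a < b\<close> this, of "sine_jet A B", OF sine_jet_has_vector_derivative]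
  show "covariant_derivative g0 {a..b} (sine_jet A B 0) (velocity {a..b} (sine_jet A B 0)) t
      + gradient g0 V0 (sine_jet A B 0 t) = 0"
    by (simp add: covariant_derivative_g0 velocity_def[abs_def] sine_jet_second assms(2))
qed (auto simp: smooth_sine_jet)

lemma u_curve_sine_jet: "u_curve \<alpha> = sine_jet (vector [\<alpha>, 0, 0]) (vector [0, 0, 1]) 0"
  by (rule ext) (simp add: u_curve_def sine_jet_def vec_eq_iff forall_3)

lemma v_curve_sine_jet: "v_curve \<alpha> = sine_jet (vector [0, \<alpha>, 0]) (vector [0, 0, 1]) 0"
  by (rule ext) (simp add: v_curve_def sine_jet_def vec_eq_iff forall_3)

lemma gamma0_u_curve: "gamma0 = u_curve 0"
  by (rule ext) (simp add: gamma0_def u_curve_def)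

lemma p_geodesic_u_curve: "a < b \<Longrightarrow> p_geodesic g0 V0 {a..b} (u_curve \<alpha>)"
  unfolding u_curve_sine_jet
  by (rule p_geodesic_sine_jet)
     (simp_all add: gradient_V0 sine_jet_def vec_eq_iff forall_3)

lemma p_geodesic_v_curve: "a < b \<Longrightarrow> p_geodesic g0 V0 {a..b} (v_curve \<alpha>)"
  unfolding v_curve_sine_jet
  by (rule p_geodesic_sine_jet)
     (simp_all add: gradient_V0 sine_jet_def vec_eq_iff forall_3)

section \<open>Conjugate and bifurcation instants\<close>

lemma conjugate_point_pi: "conjugate_point g0 V0 0 (2*pi) gamma0 pi"
proof -
  define A :: "real^3" where "A = vector [1, 0, 0]"
  define \<xi> where "\<xi> = sine_jet A 0 0"
  have \<xi>: "\<xi> t = sin t *\<^sub>R A" for t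
    by (simp add: \<xi>_def sine_jet_def)
  have "\<exists>t\<in>{0..2*pi}. \<xi> t \<noteq> 0"
    by (rule bexI[of _ "pi/2"]) (auto simp: \<xi> A_def vec_eq_iff forall_3)
  moreover have "covariant_derivative g0 {0..2*pi} gamma0 (covariant_derivative g0 {0..2*pi} gamma0 \<xi>) t
        + curvature g0 (gamma0 t) (velocity {0..2*pi} gamma0 t) (\<xi> t) (velocity {0..2*pi} gamma0 t)
        + levi_civita g0 (\<lambda>_. \<xi> t) (gradient g0 V0) (gamma0 t) = 0" if "t \<in> {0..2*pi}" for t
  proof -
    have "covariant_derivative g0 {0..2*pi} gamma0 (covariant_derivative g0 {0..2*pi} gamma0 \<xi>) t
        = - sin t *\<^sub>R A"
      using vector_derivative_twice[OF _ that, of "sine_jet A 0", OF _ sine_jet_has_vector_derivative]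
      by (simp add: covariant_derivative_g0 \<xi>_def sine_jet_second)
    then show ?thesis
      unfolding curvature_g0 levi_civita_gradient_V0_gamma0
      by (simp add: \<xi> A_def vec_eq_iff forall_3)
  qed
  ultimately show ?thesis
    unfolding conjugate_point_def
    by (intro conjI exI[of _ \<xi>]) (auto simp: \<xi> smooth_sine_jet[of _ A 0, folded \<xi>_def])
qed

text \<open>
  The third component of a Jacobi field vanishing at \<open>0\<close> is linear in \<open>t\<close> and the other two are
  multiples of \<open>sin t\<close>, so a second zero away from the zeros of \<open>sin\<close> kills all three.
\<close>
lemma conjugate_point_gamma0_unique:
  assumes "conjugate_point g0 V0 0 (2*pi) gamma0 ts"
  shows "ts = pi"
proof -
  let ?I = "{0..2*pi}"
  from assms obtain \<xi> where ts: "0 < ts" "ts < 2*pi"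
    and smooth: "smooth_curve_on ?I \<xi>" and nz: "\<exists>t\<in>?I. \<xi> t \<noteq> 0"
    and jac: "\<forall>t\<in>?I.
       covariant_derivative g0 ?I gamma0 (covariant_derivative g0 ?I gamma0 \<xi>) t
       + curvature g0 (gamma0 t) (velocity ?I gamma0 t) (\<xi> t) (velocity ?I gamma0 t)
       + levi_civita g0 (\<lambda>_. \<xi> t) (gradient g0 V0) (gamma0 t) = 0"
    and \<xi>0: "\<xi> 0 = 0" and \<xi>ts: "\<xi> ts = 0"
    unfolding conjugate_point_def greaterThanLessThan_iff
    by (elim conjE exE) (rule that)
  from smooth obtain D where D0: "D 0 = \<xi>"
    and D: "\<And>k t. t \<in> ?I \<Longrightarrow> (D k has_vector_derivative D (Suc k) t) (at t within ?I)"
    unfolding smooth_curve_on_def by blast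
  have comp: "((\<lambda>t. D k t $ i) has_real_derivative D (Suc k) t $ i) (at t within ?I)"
    if "t \<in> ?I" for k i t
    using bounded_linear.has_vector_derivative[OF bounded_linear_vec_nth D[OF that]]
    by (simp add: has_real_derivative_iff_has_vector_derivative)
  have D2: "D (Suc (Suc 0)) t = - vector [D 0 t $ 1, D 0 t $ 2, 0]" if "t \<in> ?I" for t
    using jac[rule_format, OF that] vector_derivative_twice[OF _ that, of D, OF _ D]
    unfolding curvature_g0 levi_civita_gradient_V0_gamma0 covariant_derivative_g0 D0[symmetric]
    by (simp add: numeral_2_eq_2 eq_neg_iff_add_eq_0)
  have osc: "\<xi> t $ i = D 1 0 $ i * sin t" if "t \<in> ?I" "i = 1 \<or> i = 2" for t i
    unfolding D0[symmetric]
  proof (rule harmonic_oscillator_from_zero[OF _ _ _ that(1)])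
    show "((\<lambda>t. D 0 t $ i) has_real_derivative D 1 t $ i) (at t within ?I)" if "t \<in> ?I" for t
      using comp[OF that, of 0 i] by simp
    show "((\<lambda>t. D 1 t $ i) has_real_derivative - D 0 t $ i) (at t within ?I)" if "t \<in> ?I" for t
      using comp[OF that, of 1 i] D2[OF that] \<open>i = 1 \<or> i = 2\<close> by auto
  qed (simp add: D0 \<xi>0)
  have lin: "\<xi> t $ 3 = D 1 0 $ 3 * t" if "t \<in> ?I" for t
    unfolding D0[symmetric]
  proof (rule zero_acceleration_from_zero[OF _ _ _ that])
    show "((\<lambda>t. D 0 t $ 3) has_real_derivative D 1 t $ 3) (at t within ?I)" if "t \<in> ?I" for t
      using comp[OF that, of 0 3] by simp
    show "((\<lambda>t. D 1 t $ 3) has_real_derivative 0) (at t within ?I)" if "t \<in> ?I" for t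
      using comp[OF that, of 1 3] D2[OF that] by simp
  qed (simp add: D0 \<xi>0)
  have ts_in: "ts \<in> ?I" using ts by simp
  have "sin ts = 0"
  proof (rule ccontr)
    assume "sin ts \<noteq> 0"
    then have "D 1 0 $ 1 = 0" "D 1 0 $ 2 = 0" "D 1 0 $ 3 = 0"
      using osc[OF ts_in, of 1] osc[OF ts_in, of 2] lin[OF ts_in] \<xi>ts ts by simp_all
    then have "\<xi> t = 0" if "t \<in> ?I" for t
      using osc[OF that, of 1] osc[OF that, of 2] lin[OF that] by (simp add: vec_eq_iff forall_3)
    then show False using nz by blast
  qed
  then show "ts = pi"
    using sin_gt_zero[of ts] sin_lt_zero[of ts] ts by (cases ts pi rule: linorder_cases) auto
qed

text \<open>
  The meeting time with \<open>u_curve \<alpha>\<close> does not move with \<open>\<alpha>\<close>, so the sequence of times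
  is constant and only the amplitude has to shrink.
\<close>
lemma bifurcation_point_pi: "bifurcation_point g0 V0 0 (2*pi) gamma0 pi"
proof -
  let ?I = "{0..2*pi}"
  define r :: "nat \<Rightarrow> real" where "r n = inverse (real (Suc n))" for n
  have r: "r \<longlonglongrightarrow> 0"
    unfolding r_def[abs_def] by (rule LIMSEQ_inverse_real_of_nat)
  have geodesic: "?I \<subseteq> ?I \<and> 0 \<in> ?I \<and> pi \<in> ?I \<and> p_geodesic g0 V0 ?I (u_curve (r n))" for n
    by (simp add: p_geodesic_u_curve)
  have ends: "u_curve (r n) 0 = gamma0 0" "u_curve (r n) pi = gamma0 pi" for n
    by (simp_all add: u_curve_def gamma0_def)
  have vel: "velocity ?I (u_curve \<alpha>) 0 = \<alpha> *\<^sub>R vector [1, 0, 0] + vector [0, 0, 1]" for \<alpha>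
    by (simp add: u_curve_sine_jet velocity_sine_jet vec_eq_iff forall_3)
  have "(\<lambda>n. r n *\<^sub>R vector [1, 0, 0] + vector [0, 0, 1] :: real^3)
      \<longlonglongrightarrow> 0 *\<^sub>R vector [1, 0, 0] + vector [0, 0, 1]"
    by (intro tendsto_intros r)
  then have lim: "(\<lambda>n. velocity ?I (u_curve (r n)) 0) \<longlonglongrightarrow> velocity ?I gamma0 0"
    by (simp only: gamma0_u_curve vel)
  \<comment> \<open>The deviation \<open>\<alpha> * sin t\<close> is largest at \<open>pi/2\<close>, where it equals \<open>\<alpha>\<close>.\<close>
  have "u_curve (r n) (pi/2) $ 1 \<noteq> gamma0 (pi/2) $ 1" for n
    by (simp add: u_curve_def gamma0_def r_def)
  moreover have "pi/2 \<in> ?I"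
    by simp
  ultimately have differ: "\<not> (\<forall>t\<in>?I. u_curve (r n) t = gamma0 t)" for n
    by metis
  show ?thesis
    unfolding bifurcation_point_def
    by (intro conjI allI exI[of _ "\<lambda>n. pi"] exI[of _ "\<lambda>n. ?I"] exI[of _ "\<lambda>n. u_curve (r n)"])
       (use geodesic ends lim differ in simp_all)
qed

theorem mainTheorem2:
  "p_geodesic g0 V0 {0..2*pi} gamma0 \<and>
   gamma0 pi = vector [0, 0, pi] \<and>
   conjugate_point g0 V0 0 (2*pi) gamma0 pi \<and>
   (\<forall>\<alpha>::real. p_geodesic g0 V0 {0..2*pi} (u_curve \<alpha>) \<and>
              p_geodesic g0 V0 {0..2*pi} (v_curve \<alpha>)) \<and>
   bifurcation_point g0 V0 0 (2*pi) gamma0 pi \<and>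
   (\<forall>ts\<in>{0<..<2*pi}. conjugate_point g0 V0 0 (2*pi) gamma0 ts \<longrightarrow>
      bifurcation_point g0 V0 0 (2*pi) gamma0 ts)"
proof (intro conjI allI ballI impI)
  show "p_geodesic g0 V0 {0..2*pi} gamma0"
    unfolding gamma0_u_curve by (simp add: p_geodesic_u_curve)
  fix ts assume "conjugate_point g0 V0 0 (2*pi) gamma0 ts"
  then show "bifurcation_point g0 V0 0 (2*pi) gamma0 ts"
    using conjugate_point_gamma0_unique bifurcation_point_pi by blast
qed (simp_all add: gamma0_def conjugate_point_pi p_geodesic_u_curve p_geodesic_v_curve
    bifurcation_point_pi)

end
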